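(* Let $M_1,\dots,M_k$ be matroids on the same finite ground set $E$. Suppose there are sets $V_1,\dots,V_k$ such that $V_i$ is independent in $M_i$ for each $i$, and $V_1\cup\dots\cup V_k=E$. Then Alice has a winning strategy in the generalized indicated coloring game on $M_1,\dots,M_k$.
   Context: The generalized indicated coloring game on matroids $M_1,\dots,M_k$ over a common ground set $E$: the set of colors is $\{1,\dots,k\}$. In each round Alice indicates an element of $E$ not yet colored, and Bob colors it with some color $i\in\{1,\dots,k\}$, subject to the rule that for every $i$ the set of elements colored $i$ must be independent in $M_i$. Alice wins if all of $E$ becomes colored; Bob wins if the current partial coloring cannot be extended according to the rule (i.e. Bob cannot legally color the indicated element). *)

theory Defs
  imports Main
begin

locale matroid =
  fixes carrier :: "'a set" and indep :: "'a set \<Rightarrow> bool"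
  assumes carrier_finite: "finite carrier"
    and indep_subset_carrier: "indep X \<Longrightarrow> X \<subseteq> carrier"
    and indep_empty: "indep {}"
    and indep_subset: "indep X \<Longrightarrow> Y \<subseteq> X \<Longrightarrow> indep Y"
    and augment: "indep X \<Longrightarrow> indep Y \<Longrightarrow> card Y < card X \<Longrightarrow> \<exists>x \<in> X - Y. indep (insert x Y)"

text \<open>
  The state of the game is the history of its rounds, oldest first: the entry \<open>(e, i)\<close> records
  that Alice indicated \<open>e\<close> and Bob coloured it \<open>i\<close>. The matroids are given by a family \<open>M\<close> of
  independence predicates, of which only \<open>M 1, \<dots>, M k\<close> matter.
\<close>

type_synonym 'a history = "('a \<times> nat) list"

definition colored :: "'a history \<Rightarrow> 'a set" where
  "colored h = fst ` set h"

definition color_class :: "'a history \<Rightarrow> nat \<Rightarrow> 'a set" where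
  "color_class h i = {e. (e, i) \<in> set h}"

definition obeys_rule :: "nat \<Rightarrow> (nat \<Rightarrow> 'a set \<Rightarrow> bool) \<Rightarrow> 'a history \<Rightarrow> bool" where
  "obeys_rule k M h \<longleftrightarrow> (\<forall>i \<in> {1..k}. M i (color_class h i))"

definition legal_reply ::
  "nat \<Rightarrow> (nat \<Rightarrow> 'a set \<Rightarrow> bool) \<Rightarrow> 'a history \<Rightarrow> 'a \<Rightarrow> nat \<Rightarrow> bool" where
  "legal_reply k M h e i \<longleftrightarrow> i \<in> {1..k} \<and> obeys_rule k M (h @ [(e, i)])"

text \<open>
  A strategy of Alice maps each history to the element she indicates next. The following are
  the histories that can arise when she follows \<open>\<sigma>\<close> and Bob plays arbitrary legal replies.
\<close>

inductive play ::
  "'a set \<Rightarrow> nat \<Rightarrow> (nat \<Rightarrow> 'a set \<Rightarrow> bool) \<Rightarrow> ('a history \<Rightarrow> 'a) \<Rightarrow> 'a history \<Rightarrow> bool"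
  for E k M \<sigma> where
  start: "play E k M \<sigma> []"
| round: "play E k M \<sigma> h \<Longrightarrow> \<sigma> h \<in> E - colored h \<Longrightarrow> legal_reply k M h (\<sigma> h) i
    \<Longrightarrow> play E k M \<sigma> (h @ [(\<sigma> h, i)])"

definition alice_won :: "'a set \<Rightarrow> 'a history \<Rightarrow> bool" where
  "alice_won E h \<longleftrightarrow> colored h = E"

definition bob_won ::
  "nat \<Rightarrow> (nat \<Rightarrow> 'a set \<Rightarrow> bool) \<Rightarrow> ('a history \<Rightarrow> 'a) \<Rightarrow> 'a history \<Rightarrow> bool" where
  "bob_won k M \<sigma> h \<longleftrightarrow> (\<nexists>i. legal_reply k M h (\<sigma> h) i)"

text \<open>
  Every round colours a new element, so on a finite ground set every play ends. Hence \<open>\<sigma>\<close>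
  is winning as soon as no play following it gets stuck before all of \<open>E\<close> is coloured: Alice
  always indicates an uncoloured element of \<open>E\<close>, and Bob always has a legal reply.
\<close>

definition winning_strategy ::
  "'a set \<Rightarrow> nat \<Rightarrow> (nat \<Rightarrow> 'a set \<Rightarrow> bool) \<Rightarrow> ('a history \<Rightarrow> 'a) \<Rightarrow> bool" where
  "winning_strategy E k M \<sigma> \<longleftrightarrow>
    (\<forall>h. play E k M \<sigma> h \<and> \<not> alice_won E h \<longrightarrow> \<sigma> h \<in> E - colored h \<and> \<not> bob_won k M \<sigma> h)"

lemma play_colored_subset: "play E k M \<sigma> h \<Longrightarrow> colored h \<subseteq> E"
  by (induction rule: play.induct) (auto simp: colored_def)

lemma play_length_eq_card: "play E k M \<sigma> h \<Longrightarrow> length h = card (colored h)"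
  by (induction rule: play.induct) (auto simp: colored_def)

lemma play_length_le: "finite E \<Longrightarrow> play E k M \<sigma> h \<Longrightarrow> length h \<le> card E"
  by (simp add: play_length_eq_card play_colored_subset card_mono)

end

theory Submission
  imports Defs
begin

text \<open>
  Let \<open>r\<^sub>i\<close> be the rank function of \<open>M\<^sub>i\<close> contracted by the elements already coloured \<open>i\<close>. Alice
  maintains \<open>|A| \<le> (\<Sum>i. r\<^sub>i A)\<close> for all sets \<open>A\<close> of uncoloured elements. For a singleton \<open>A\<close> this
  says that Bob has a legal reply. If Bob colours \<open>e\<close> with \<open>i\<close>, the condition can only fail at a
  tight nonempty set \<open>A\<close> (one where equality holds) that avoids \<open>e\<close> but spans it in the
  contracted \<open>M\<^sub>i\<close>. Alice therefore indicates an element \<open>e\<close> of a minimal nonempty tight set \<open>T\<close>: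
  by submodularity a tight \<open>A\<close> avoiding \<open>e\<close> must be disjoint from \<open>T\<close>, and then \<open>A \<union> T\<close> would
  violate the condition if \<open>A\<close> spanned \<open>e\<close>.
\<close>

section \<open>Rank functions of matroids and of their contractions\<close>

context matroid
begin

definition rank :: "'a set \<Rightarrow> nat" where
  "rank S = Max (card ` {X. indep X \<and> X \<subseteq> S})"

lemma finite_indep_subsets: "finite {X. indep X \<and> X \<subseteq> S}"
  \<comment> \<open>\<open>S\<close> may be infinite, but independent sets lie in the finite
    carrier, so the \<open>Max\<close> in \<open>rank\<close> is over a finite set.\<close>
  by (rule finite_subset[of _ "Pow carrier"]) (auto simp: carrier_finite dest: indep_subset_carrier)

lemma card_le_rank: "indep X \<Longrightarrow> X \<subseteq> S \<Longrightarrow> card X \<le> rank S"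
  unfolding rank_def by (rule Max_ge) (auto simp: finite_indep_subsets)

lemma indep_finite: "indep X \<Longrightarrow> finite X"
  using carrier_finite finite_subset indep_subset_carrier by blast

lemma rank_attained: obtains X where "indep X" "X \<subseteq> S" "card X = rank S"
proof -
  have "rank S \<in> card ` {X. indep X \<and> X \<subseteq> S}"
    unfolding rank_def
    by (rule Max_in) (use finite_indep_subsets indep_empty in auto)
  then show thesis using that by auto
qed

lemma rank_mono:
  assumes "S \<subseteq> T"
  shows "rank S \<le> rank T"
proof -
  obtain X where "indep X" "X \<subseteq> S" "card X = rank S" by (rule rank_attained)
  then show ?thesis using card_le_rank[of X T] assms by simp
qed

lemma rank_indep:
  assumes "indep X"
  shows "rank X = card X"
proof -
  obtain Y where "indep Y" "Y \<subseteq> X" "card Y = rank X" by (rule rank_attained)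
  then show ?thesis
    using card_le_rank[OF assms subset_refl] card_mono[OF indep_finite[OF assms], of Y] by simp
qed

lemma indep_if_card_le_rank:
  assumes "finite S" "card S \<le> rank S"
  shows "indep S"
proof -
  obtain X where "indep X" "X \<subseteq> S" "card X = rank S" by (rule rank_attained)
  then show ?thesis using card_seteq[of S X] assms by simp
qed

text \<open>A largest independent set between \<open>X\<close> and \<open>S\<close> works: if it
  were smaller than \<open>rank S\<close>, augmenting it from an independent subset of
  \<open>S\<close> of that size would enlarge it within \<open>S\<close>.\<close>

lemma extend_to_rank:
  assumes "indep X" "X \<subseteq> S"
  obtains Y where "indep Y" "X \<subseteq> Y" "Y \<subseteq> S" "card Y = rank S"
proof -
  let ?P = "\<lambda>Y. indep Y \<and> X \<subseteq> Y \<and> Y \<subseteq> S"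
  have "?P X" using assms by simp
  moreover have "\<forall>Y. ?P Y \<longrightarrow> card Y < Suc (rank S)"
    by (auto simp: less_Suc_eq_le card_le_rank)
  ultimately obtain Y where Y: "?P Y" and max: "\<And>Z. ?P Z \<Longrightarrow> card Z \<le> card Y"
    using ex_has_greatest_nat[of ?P X card "Suc (rank S)"] by blast
  have "card Y = rank S"
  proof (rule ccontr)
    assume "card Y \<noteq> rank S"
    then have less: "card Y < rank S"
      using Y card_le_rank[of Y S] by simp
    obtain Z where Z: "indep Z" "Z \<subseteq> S" "card Z = rank S" by (rule rank_attained)
    then obtain z where "z \<in> Z - Y" "indep (insert z Y)"
      using augment[of Z Y] Y less by auto
    moreover from this have "card (insert z Y) \<le> card Y"
      using Y Z by (intro max) auto
    ultimately show False using Y indep_finite by simp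
  qed
  with Y that show thesis by blast
qed

text \<open>Extend a maximum independent subset \<open>B\<close> of \<open>S \<inter> T\<close> to a
  maximum independent subset \<open>C\<close> of \<open>S \<union> T\<close>. The traces of
  \<open>C\<close> on \<open>S\<close> and on \<open>T\<close> are independent, cover
  \<open>C\<close> and share at least \<open>B\<close>; counting them gives the bound.\<close>

lemma rank_submodular: "rank (S \<union> T) + rank (S \<inter> T) \<le> rank S + rank T"
proof -
  obtain B where B: "indep B" "B \<subseteq> S \<inter> T" "card B = rank (S \<inter> T)" by (rule rank_attained)
  then obtain C where C: "indep C" "B \<subseteq> C" "C \<subseteq> S \<union> T" "card C = rank (S \<union> T)"
    using extend_to_rank[of B "S \<union> T"] by blast
  have fin: "finite C" using C indep_finite by blast
  have "card B \<le> card (C \<inter> S \<inter> (C \<inter> T))"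
    using B C fin by (intro card_mono) auto
  then have "rank (S \<union> T) + rank (S \<inter> T) \<le> card C + card (C \<inter> S \<inter> (C \<inter> T))"
    using B C by simp
  also have "card C = card (C \<inter> S \<union> C \<inter> T)"
    using C(3) by (intro arg_cong[where f = card]) blast
  also have "\<dots> + card (C \<inter> S \<inter> (C \<inter> T)) = card (C \<inter> S) + card (C \<inter> T)"
    using card_Un_Int[of "C \<inter> S" "C \<inter> T"] fin by simp
  also have "\<dots> \<le> rank S + rank T"
    using C by (intro add_mono card_le_rank indep_subset[OF C(1)]) auto
  finally show ?thesis .
qed

text \<open>For independent \<open>C\<close> this is the rank function of the contraction by \<open>C\<close>.\<close>

definition contracted_rank :: "'a set \<Rightarrow> 'a set \<Rightarrow> int" where
  "contracted_rank C A = int (rank (A \<union> C)) - int (card C)"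

lemma contracted_rank_empty: "indep C \<Longrightarrow> contracted_rank C {} = 0"
  by (simp add: contracted_rank_def rank_indep)

lemma contracted_rank_mono: "A \<subseteq> B \<Longrightarrow> contracted_rank C A \<le> contracted_rank C B"
  unfolding contracted_rank_def using rank_mono[of "A \<union> C" "B \<union> C"] by auto

lemma contracted_rank_submodular:
  "contracted_rank C (A \<union> B) + contracted_rank C (A \<inter> B)
    \<le> contracted_rank C A + contracted_rank C B"
proof -
  have "(A \<union> C) \<union> (B \<union> C) = A \<union> B \<union> C" "(A \<union> C) \<inter> (B \<union> C) = A \<inter> B \<union> C" by auto
  then show ?thesis
    unfolding contracted_rank_def using rank_submodular[of "A \<union> C" "B \<union> C"] by simp
qed

text \<open>Describes the effect of Bob's move: shifting \<open>e\<close> from the argument into the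
  contracted set keeps their union, and one more element is subtracted.\<close>

lemma contracted_rank_insert:
  assumes "finite C" "e \<notin> C"
  shows "contracted_rank (insert e C) A = contracted_rank C (insert e A) - 1"
  using assms by (simp add: contracted_rank_def)

text \<open>Non-loops of the contraction by \<open>C\<close> are the elements that may join
  \<open>C\<close>; this turns legality of a reply into a rank condition.\<close>

lemma contracted_rank_singleton_pos_iff:
  assumes "indep C" "e \<notin> C"
  shows "1 \<le> contracted_rank C {e} \<longleftrightarrow> indep (insert e C)"
  using assms indep_finite[OF assms(1)] indep_if_card_le_rank[of "insert e C"]
    rank_indep[of "insert e C"]
  by (auto simp: contracted_rank_def)

end

section \<open>Choosing an element by submodularity\<close>

text \<open>Alice's choice, abstracted from the game to normalized, monotone, submodular functions.
  In the application \<open>1 \<le> \<rho> i {e}\<close> says that colour \<open>i\<close> is legal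
  for \<open>e\<close>, and the final inequality is Alice's condition after that reply.\<close>

lemma safe_element_exists:
  fixes \<rho> :: "'i \<Rightarrow> 'a set \<Rightarrow> int"
  assumes "finite I" "finite U" "U \<noteq> {}"
    and empty: "\<And>i. i \<in> I \<Longrightarrow> \<rho> i {} = 0"
    and mono: "\<And>i A B. i \<in> I \<Longrightarrow> A \<subseteq> B \<Longrightarrow> \<rho> i A \<le> \<rho> i B"
    and submodular: "\<And>i A B. i \<in> I \<Longrightarrow> \<rho> i (A \<union> B) + \<rho> i (A \<inter> B) \<le> \<rho> i A + \<rho> i B"
    and bound: "\<And>A. A \<subseteq> U \<Longrightarrow> int (card A) \<le> (\<Sum>i\<in>I. \<rho> i A)"
  obtains e where "e \<in> U"
    "\<And>i A. i \<in> I \<Longrightarrow> 1 \<le> \<rho> i {e} \<Longrightarrow> A \<subseteq> U - {e} \<Longrightarrow>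
      int (card A) \<le> \<rho> i (insert e A) - 1 + (\<Sum>j\<in>I - {i}. \<rho> j A)"
proof -
  define tight where "tight A \<longleftrightarrow> A \<subseteq> U \<and> A \<noteq> {} \<and> (\<Sum>i\<in>I. \<rho> i A) = int (card A)" for A
  \<comment> \<open>By integrality, a violation bounds \<open>\<rho> i (insert e A)\<close> plus the
    other terms by \<open>card A\<close>; \<open>bound\<close> and monotonicity then force equality
    throughout. The empty set is never violated, since its right-hand side is
    \<open>\<rho> i {e} - 1\<close>.\<close>
  have tight_if_violated: "tight A \<and> \<rho> i (insert e A) = \<rho> i A"
    if "i \<in> I" "1 \<le> \<rho> i {e}" "A \<subseteq> U - {e}"
      and "\<not> int (card A) \<le> \<rho> i (insert e A) - 1 + (\<Sum>j\<in>I - {i}. \<rho> j A)" for e i A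
  proof -
    have "(\<Sum>j\<in>I. \<rho> j A) = \<rho> i A + (\<Sum>j\<in>I - {i}. \<rho> j A)"
      using \<open>finite I\<close> that(1) by (rule sum.remove)
    moreover have "A \<noteq> {}"
      using that empty by auto
    moreover have AU: "A \<subseteq> U" using that(3) by blast
    moreover have "int (card A) \<le> (\<Sum>j\<in>I. \<rho> j A)" by (rule bound[OF AU])
    moreover have "\<rho> i A \<le> \<rho> i (insert e A)" using that(1) by (intro mono) auto
    ultimately show ?thesis
      using that(4) unfolding tight_def by linarith
  qed
  show thesis
  proof (cases "\<exists>T. tight T")
    case False
    \<comment> \<open>Without tight sets no violation can occur, so any element of \<open>U\<close>
      will do.\<close>
    then show thesis using \<open>U \<noteq> {}\<close> tight_if_violated that by blast
  next
    case True
    then obtain T where T: "tight T" and min: "\<And>A. tight A \<Longrightarrow> card T \<le> card A"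
      using ex_has_least_nat[of tight _ card] by blast
    then obtain e where e: "e \<in> T" "e \<in> U" unfolding tight_def by blast
    have finT: "finite T" using T \<open>finite U\<close> finite_subset unfolding tight_def by blast
    show thesis
    proof (rule that[OF e(2)], rule ccontr)
      fix i A
      assume i: "i \<in> I" "1 \<le> \<rho> i {e}" and A: "A \<subseteq> U - {e}"
        and "\<not> int (card A) \<le> \<rho> i (insert e A) - 1 + (\<Sum>j\<in>I - {i}. \<rho> j A)"
      then have tightA: "tight A" and spanned: "\<rho> i (insert e A) = \<rho> i A"
        using tight_if_violated by blast+
      have finA: "finite A" using A \<open>finite U\<close> finite_subset by blast
      have sums: "(\<Sum>j\<in>I. \<rho> j T + \<rho> j A) = int (card (T \<union> A)) + int (card (T \<inter> A))"
        using T tightA card_Un_Int[OF finT finA] by (simp add: tight_def sum.distrib)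
      have union: "int (card (T \<union> A)) \<le> (\<Sum>j\<in>I. \<rho> j (T \<union> A))"
        using T A by (intro bound) (auto simp: tight_def)
      show False
      proof (cases "T \<inter> A = {}")
        case False
        \<comment> \<open>Summed submodularity and the lower bounds for union and intersection force
          \<open>T \<inter> A\<close> to be tight. It misses \<open>e\<close>, so it is smaller than
          the minimal \<open>T\<close>.\<close>
        have "(\<Sum>j\<in>I. \<rho> j (T \<union> A)) + (\<Sum>j\<in>I. \<rho> j (T \<inter> A)) \<le> (\<Sum>j\<in>I. \<rho> j T + \<rho> j A)"
          unfolding sum.distrib[symmetric] by (intro sum_mono submodular)
        moreover have "int (card (T \<inter> A)) \<le> (\<Sum>j\<in>I. \<rho> j (T \<inter> A))"
          using A by (intro bound) auto
        ultimately have "(\<Sum>j\<in>I. \<rho> j (T \<inter> A)) = int (card (T \<inter> A))"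
          using sums union by linarith
        then have "tight (T \<inter> A)"
          using False A by (auto simp: tight_def)
        then have "card T \<le> card (T \<inter> A)" by (rule min)
        moreover have "card (T \<inter> A) < card T"
          using A e finT by (intro psubset_card_mono) auto
        ultimately show False by simp
      next
        case True
        \<comment> \<open>Submodularity for \<open>T\<close> and \<open>insert e A\<close> has the
          positive term \<open>\<rho> i {e}\<close> on the left, and \<open>spanned\<close> replaces
          \<open>\<rho> i (insert e A)\<close> by \<open>\<rho> i A\<close>. This single strict
          inequality pushes the sum for \<open>T \<union> A\<close> below
          \<open>card (T \<union> A)\<close>.\<close>
        have "T \<union> insert e A = T \<union> A" "T \<inter> insert e A = {e}" using e True by auto
        then have "\<rho> i (T \<union> A) < \<rho> i T + \<rho> i A"
          using submodular[OF i(1), of T "insert e A"] i(2) spanned by simp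
        moreover have "\<rho> j (T \<union> A) \<le> \<rho> j T + \<rho> j A" if "j \<in> I" for j
          using submodular[OF that, of T A] empty[OF that] True by simp
        ultimately have "(\<Sum>j\<in>I. \<rho> j (T \<union> A)) < (\<Sum>j\<in>I. \<rho> j T + \<rho> j A)"
          using \<open>finite I\<close> i(1) by (intro sum_strict_mono_ex1) auto
        then show False using sums union True by simp
      qed
    qed
  qed
qed

section \<open>Alice's invariant during the game\<close>

lemma color_class_snoc:
  "color_class (h @ [(e, i)]) j = (if j = i then insert e (color_class h i) else color_class h j)"
  by (auto simp: color_class_def)

lemma colored_snoc: "colored (h @ [(e, i)]) = insert e (colored h)"
  by (simp add: colored_def)

lemma color_class_subset_colored: "color_class h i \<subseteq> colored h"
  by (force simp: color_class_def colored_def)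

text \<open>For matroids, the second conjunct is the rank condition of the matroid union theorem for
  covering the uncoloured elements by independent sets of the contractions. The first makes the
  colour classes independent, so that \<open>contracted_rank\<close> really is the rank of a
  contraction.\<close>

definition alice_safe :: "'a set \<Rightarrow> nat \<Rightarrow> (nat \<Rightarrow> 'a set \<Rightarrow> bool) \<Rightarrow> 'a history \<Rightarrow> bool" where
  "alice_safe E k M h \<longleftrightarrow> obeys_rule k M h \<and>
    (\<forall>A \<subseteq> E - colored h.
      int (card A) \<le> (\<Sum>i\<in>{1..k}. matroid.contracted_rank (M i) (color_class h i) A))"

text \<open>The rule already holds for \<open>h\<close> and only class \<open>i\<close> changes, so
  legality is independence of that class with \<open>e\<close> added.\<close>

lemma legal_reply_iff:
  assumes "matroid E (M i)" "i \<in> {1..k}" "obeys_rule k M h" "e \<notin> colored h"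
  shows "legal_reply k M h e i \<longleftrightarrow>
    1 \<le> matroid.contracted_rank (M i) (color_class h i) {e}"
proof -
  have "e \<notin> color_class h i" using assms(4) color_class_subset_colored[of h i] by blast
  moreover have "M i (color_class h i)" using assms(2,3) by (simp add: obeys_rule_def)
  moreover have "legal_reply k M h e i \<longleftrightarrow> M i (insert e (color_class h i))"
    using assms(2,3) by (auto simp: legal_reply_def obeys_rule_def color_class_snoc)
  ultimately show ?thesis
    using matroid.contracted_rank_singleton_pos_iff[OF assms(1)] by blast
qed

text \<open>The traces \<open>A \<inter> V i\<close> cover \<open>A\<close>, and each is an
  independent subset of \<open>A\<close>, hence no larger than the rank of \<open>A\<close> in
  \<open>M i\<close>.\<close>

lemma alice_safe_Nil:
  assumes matroids: "\<And>i. i \<in> {1..k} \<Longrightarrow> matroid E (M i)"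
    and indep: "\<And>i. i \<in> {1..k} \<Longrightarrow> M i (V i)"
    and cover: "(\<Union>i\<in>{1..k}. V i) = E"
  shows "alice_safe E k M []"
proof -
  have "int (card A) \<le> (\<Sum>i\<in>{1..k}. matroid.contracted_rank (M i) {} A)" if "A \<subseteq> E" for A
  proof -
    have "A = (\<Union>i\<in>{1..k}. A \<inter> V i)" using that cover by blast
    then have "card A \<le> (\<Sum>i\<in>{1..k}. card (A \<inter> V i))"
      using card_UN_le[of "{1..k}" "\<lambda>i. A \<inter> V i"] by simp
    also have "\<dots> \<le> (\<Sum>i\<in>{1..k}. matroid.rank (M i) A)"
    proof (rule sum_mono)
      fix i assume i: "i \<in> {1..k}"
      interpret matroid E "M i" by (rule matroids[OF i])
      show "card (A \<inter> V i) \<le> rank A"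
        by (intro card_le_rank indep_subset[OF indep[OF i]]) auto
    qed
    finally have "int (card A) \<le> (\<Sum>i\<in>{1..k}. int (matroid.rank (M i) A))"
      by (simp flip: of_nat_sum)
    also have "\<dots> = (\<Sum>i\<in>{1..k}. matroid.contracted_rank (M i) {} A)"
      by (intro sum.cong) (auto simp: matroid.contracted_rank_def[OF matroids])
    finally show ?thesis .
  qed
  then show ?thesis
    using matroid.indep_empty[OF matroids]
    by (simp add: alice_safe_def obeys_rule_def color_class_def colored_def)
qed

lemma legal_reply_exists:
  assumes matroids: "\<And>i. i \<in> {1..k} \<Longrightarrow> matroid E (M i)"
    and safe: "alice_safe E k M h"
    and e: "e \<in> E - colored h"
  shows "\<exists>i. legal_reply k M h e i"
proof -
  let ?\<rho> = "\<lambda>i. matroid.contracted_rank (M i) (color_class h i) {e}"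
  have rule: "obeys_rule k M h" and "int (card {e}) \<le> (\<Sum>i\<in>{1..k}. ?\<rho> i)"
    using safe e unfolding alice_safe_def by blast+
  then have "\<not> (\<Sum>i\<in>{1..k}. ?\<rho> i) \<le> 0" by simp
  then have "\<not> (\<forall>i\<in>{1..k}. ?\<rho> i \<le> 0)" using sum_nonpos[of "{1..k}" ?\<rho>] by blast
  then obtain i where i: "i \<in> {1..k}" and "\<not> ?\<rho> i \<le> 0" by blast
  then have "1 \<le> ?\<rho> i" by linarith
  then show ?thesis
    using legal_reply_iff[OF matroids[OF i] i rule, of e] e by blast
qed

lemma safe_indication_exists:
  assumes "finite E"
    and matroids: "\<And>i. i \<in> {1..k} \<Longrightarrow> matroid E (M i)"
    and safe: "alice_safe E k M h"
    and uncolored: "E - colored h \<noteq> {}"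
  shows "\<exists>e \<in> E - colored h. \<forall>i. legal_reply k M h e i \<longrightarrow> alice_safe E k M (h @ [(e, i)])"
proof -
  define \<rho> where "\<rho> i = matroid.contracted_rank (M i) (color_class h i)" for i
  have rule: "obeys_rule k M h"
    and bound: "\<And>A. A \<subseteq> E - colored h \<Longrightarrow> int (card A) \<le> (\<Sum>i\<in>{1..k}. \<rho> i A)"
    using safe by (auto simp: alice_safe_def \<rho>_def)
  have indep: "M i (color_class h i)" if "i \<in> {1..k}" for i
    using rule that by (simp add: obeys_rule_def)
  obtain e where e: "e \<in> E - colored h"
    and step: "\<And>i A. i \<in> {1..k} \<Longrightarrow> 1 \<le> \<rho> i {e} \<Longrightarrow> A \<subseteq> E - colored h - {e} \<Longrightarrow>
      int (card A) \<le> \<rho> i (insert e A) - 1 + (\<Sum>j\<in>{1..k} - {i}. \<rho> j A)"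
  proof (rule safe_element_exists[of "{1..k}" "E - colored h" \<rho>])
    show "\<rho> i {} = 0" if "i \<in> {1..k}" for i
      unfolding \<rho>_def by (rule matroid.contracted_rank_empty[OF matroids[OF that] indep[OF that]])
    show "\<rho> i A \<le> \<rho> i B" if "i \<in> {1..k}" "A \<subseteq> B" for i A B
      unfolding \<rho>_def by (rule matroid.contracted_rank_mono[OF matroids[OF that(1)] that(2)])
    show "\<rho> i (A \<union> B) + \<rho> i (A \<inter> B) \<le> \<rho> i A + \<rho> i B" if "i \<in> {1..k}" for i A B
      unfolding \<rho>_def by (rule matroid.contracted_rank_submodular[OF matroids[OF that]])
  qed (use \<open>finite E\<close> uncolored bound in auto)
  have "alice_safe E k M (h @ [(e, i)])" if reply: "legal_reply k M h e i" for i
  proof -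
    let ?h = "h @ [(e, i)]"
    have i: "i \<in> {1..k}" and rule': "obeys_rule k M ?h"
      using reply by (auto simp: legal_reply_def)
    interpret matroid E "M i" by (rule matroids[OF i])
    have pos: "1 \<le> \<rho> i {e}"
      using reply legal_reply_iff[OF matroids[OF i] i rule] e by (simp add: \<rho>_def)
    \<comment> \<open>The reply costs exactly one in the rank for colour \<open>i\<close>; the other
      colour classes, and so their ranks, stay as they were. Thus \<open>step\<close> becomes the
      invariant for \<open>?h\<close>.\<close>
    have new: "contracted_rank (color_class ?h i) A = \<rho> i (insert e A) - 1" for A
      using e color_class_subset_colored[of h i] indep_finite[OF indep[OF i]]
      by (auto simp: color_class_snoc \<rho>_def intro!: contracted_rank_insert)
    have "int (card A) \<le> (\<Sum>j\<in>{1..k}. matroid.contracted_rank (M j) (color_class ?h j) A)"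
      if A: "A \<subseteq> E - colored ?h" for A
    proof -
      have "int (card A) \<le> \<rho> i (insert e A) - 1 + (\<Sum>j\<in>{1..k} - {i}. \<rho> j A)"
        using A by (intro step i pos) (auto simp: colored_snoc)
      also have "(\<Sum>j\<in>{1..k} - {i}. \<rho> j A) =
          (\<Sum>j\<in>{1..k} - {i}. matroid.contracted_rank (M j) (color_class ?h j) A)"
        by (intro sum.cong) (auto simp: \<rho>_def color_class_snoc)
      also have "\<rho> i (insert e A) - 1 + \<dots> =
          (\<Sum>j\<in>{1..k}. matroid.contracted_rank (M j) (color_class ?h j) A)"
        using i by (simp add: sum.remove[of _ i] new)
      finally show ?thesis .
    qed
    with rule' show ?thesis by (simp add: alice_safe_def)
  qed
  with e show ?thesis by blast
qed

section \<open>From the invariant to a winning strategy\<close>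

theorem theorem3:
  fixes E :: "'a set" and k :: nat and M :: "nat \<Rightarrow> 'a set \<Rightarrow> bool" and V :: "nat \<Rightarrow> 'a set"
  assumes "finite E"
    and "\<And>i. i \<in> {1..k} \<Longrightarrow> matroid E (M i)"
    and "\<And>i. i \<in> {1..k} \<Longrightarrow> M i (V i)"
    and "(\<Union>i\<in>{1..k}. V i) = E"
  shows "\<exists>\<sigma>. winning_strategy E k M \<sigma>"
proof -
  \<comment> \<open>The condition on \<open>h\<close> sits inside the existential so that choice
    yields a total \<open>\<sigma>\<close>; its values on unsafe or fully coloured histories are
    arbitrary.\<close>
  have "\<forall>h. \<exists>e. alice_safe E k M h \<and> E - colored h \<noteq> {} \<longrightarrow>
      e \<in> E - colored h \<and> (\<forall>i. legal_reply k M h e i \<longrightarrow> alice_safe E k M (h @ [(e, i)]))"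
    using safe_indication_exists[of E k M, OF assms(1,2)] by blast
  then obtain \<sigma> where \<sigma>: "\<And>h. alice_safe E k M h \<Longrightarrow> E - colored h \<noteq> {} \<Longrightarrow>
      \<sigma> h \<in> E - colored h \<and> (\<forall>i. legal_reply k M h (\<sigma> h) i \<longrightarrow> alice_safe E k M (h @ [(\<sigma> h, i)]))"
    by metis
  have safe: "alice_safe E k M h" if "play E k M \<sigma> h" for h
    using that
  proof (induction rule: play.induct)
    case start
    show ?case by (rule alice_safe_Nil[of k E M, OF assms(2-4)])
  next
    \<comment> \<open>The round itself supplies an uncoloured element, so \<open>\<sigma>\<close> is
      constrained at the safe history \<open>h\<close>, and every legal reply keeps it safe.\<close>
    case (round h i)
    then show ?case using \<sigma> by blast
  qed
  have "\<sigma> h \<in> E - colored h \<and> \<not> bob_won k M \<sigma> h"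
    if "play E k M \<sigma> h" "\<not> alice_won E h" for h
  proof -
    have "E - colored h \<noteq> {}"
      using that play_colored_subset unfolding alice_won_def by blast
    then have "\<sigma> h \<in> E - colored h" using \<sigma> safe[OF that(1)] by blast
    then show ?thesis
      using legal_reply_exists[of k E M, OF assms(2) safe[OF that(1)]] by (auto simp: bob_won_def)
  qed
  then show ?thesis unfolding winning_strategy_def by blast
qed

end
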